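(* Let $n\ge3$, $\lambda\in\mathbb{C}$, and let $\varphi$ be a $\frac12$-derivation of the Lie algebra $\mathfrak{r}_{2n+1}(\lambda)$. Then there are complex numbers $\alpha_1,\alpha_3,\dots,\alpha_{2n},\beta_{2n-1},\beta_{2n},\delta_{2n}$ satisfying $$(2n-3-\lambda)\beta_{2n-1}=0,\qquad (2n-5+2\lambda)\alpha_i=0\quad (3\le i\le 2n),$$ such that $$\varphi(e_1)=\alpha_1e_1+\sum_{i=3}^{2n}\alpha_ie_i,\qquad \varphi(e_2)=\alpha_1e_2+\beta_{2n-1}e_{2n-1}+\beta_{2n}e_{2n},$$ $$\varphi(e_i)=\alpha_1e_i+\frac{(-1)^{i-1}}{2}\alpha_{2n+2-i}e_{2n}\ (3\le i\le 2n-1),\qquad \varphi(e_{2n})=\alpha_1e_{2n},$$ $$\varphi(x)=\sum_{i=2}^{2n-2}\frac{2i-2n-1}{2}\alpha_{i+1}e_i+(3-2n)\beta_{2n}e_{2n-1}+\delta_{2n}e_{2n}+\alpha_1x.$$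
   Context: All algebras are over $\mathbb{C}$. A $\frac12$-derivation of a Lie algebra $(\mathfrak{L},[-,-])$ is a linear map $\varphi:\mathfrak{L}\to\mathfrak{L}$ with $\varphi([u,v])=\frac12([\varphi(u),v]+[u,\varphi(v)])$ for all $u,v\in\mathfrak{L}$. $\mathfrak{r}_{2n+1}(\lambda)$ is the $(2n+1)$-dimensional Lie algebra with basis $e_1,\dots,e_{2n},x$ and brackets $[e_i,e_1]=e_{i+1}$ for $2\le i\le 2n-2$; $[e_i,e_{2n+1-i}]=(-1)^ie_{2n}$ for $2\le i\le n$; $[e_1,x]=e_1$; $[e_i,x]=(i-2+\lambda)e_i$ for $2\le i\le 2n-1$; $[e_{2n},x]=(2n-3+2\lambda)e_{2n}$; brackets of basis elements not determined by these and antisymmetry are zero. *)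

theory Defs
  imports Complex_Main
begin

locale lie_algebra = vector_space scale
  for scale :: "complex \<Rightarrow> 'a::ab_group_add \<Rightarrow> 'a" (infixr "*s" 75) +
  fixes br :: "'a \<Rightarrow> 'a \<Rightarrow> 'a"
  assumes linear_br_left: "Vector_Spaces.linear scale scale (\<lambda>u. br u v)"
    and linear_br_right: "Vector_Spaces.linear scale scale (\<lambda>v. br u v)"
    and br_self: "br u u = 0"
    and jacobi: "br u (br v w) + br v (br w u) + br w (br u v) = 0"
begin

definition half_derivation :: "('a \<Rightarrow> 'a) \<Rightarrow> bool" where
  "half_derivation \<phi> \<longleftrightarrow>
     Vector_Spaces.linear scale scale \<phi> \<and>
     (\<forall>u v. \<phi> (br u v) = (1 / 2) *s (br (\<phi> u) v + br u (\<phi> v)))"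

end

(* The Lie algebra r_{2n+1}(l), presented by its basis e 1, ..., e (2n), x; the values of e
   outside {1..2n} are irrelevant. By antisymmetry it suffices to prescribe br (e i) (e j) for
   one order of each pair; br_zero covers the pairs i < j for which neither br (e i) (e j) nor
   br (e j) (e i) is prescribed by br_e1 and br_anti. *)
locale lie_algebra_r = lie_algebra scale br
  for scale :: "complex \<Rightarrow> 'a::ab_group_add \<Rightarrow> 'a" (infixr "*s" 75)
    and br :: "'a \<Rightarrow> 'a \<Rightarrow> 'a" +
  fixes n :: nat and l :: complex and e :: "nat \<Rightarrow> 'a" and x :: 'a
  assumes basis_distinct: "inj_on e {1..2*n}" "x \<notin> e ` {1..2*n}"
    and basis_independent: "independent (insert x (e ` {1..2*n}))"
    and basis_span: "span (insert x (e ` {1..2*n})) = UNIV"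
    and br_e1: "\<And>i. 2 \<le> i \<Longrightarrow> i \<le> 2*n - 2 \<Longrightarrow> br (e i) (e 1) = e (i + 1)"
    and br_anti: "\<And>i. 2 \<le> i \<Longrightarrow> i \<le> n \<Longrightarrow> br (e i) (e (2*n + 1 - i)) = (-1) ^ i *s e (2*n)"
    and br_zero: "\<And>i j. 1 \<le> i \<Longrightarrow> i < j \<Longrightarrow> j \<le> 2*n \<Longrightarrow>
       \<not> (i = 1 \<and> 2 \<le> j \<and> j \<le> 2*n - 2) \<Longrightarrow>
       \<not> (2 \<le> i \<and> i \<le> n \<and> j = 2*n + 1 - i) \<Longrightarrow> br (e i) (e j) = 0"
    and br_e1_x: "br (e 1) x = e 1"
    and br_e_x: "\<And>i. 2 \<le> i \<Longrightarrow> i \<le> 2*n - 1 \<Longrightarrow> br (e i) x = (of_nat i - 2 + l) *s e i"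
    and br_e2n_x: "br (e (2*n)) x = (2 * of_nat n - 3 + 2 * l) *s e (2*n)"

end

theory Submission
  imports Defs
begin

text \<open>
  Write \<open>\<phi>\<close> as a matrix in the basis \<open>x, e 1, \<dots>, e (2*n)\<close> and compare coordinates in the
  \<open>1/2\<close>-derivation identity on pairs of basis vectors. The pairs \<open>(e j, e 1)\<close> determine the
  columns \<open>3, \<dots>, 2*n - 1\<close> from columns \<open>1\<close> and \<open>2\<close>, a subdiagonal entry of column \<open>2\<close> being
  halved at each step to the right. The pairs \<open>(e 2, e j)\<close> relate such an entry, up to sign, to
  its own image after at least one halving, so all but two of these entries vanish. The pairs
  \<open>(u, x)\<close> then give the image of \<open>x\<close> and the two constraints. For exceptional \<open>l\<close> some of the
  equations degenerate, but never all equations for the same entry at once.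
\<close>

section \<open>Bilinearity and antisymmetry of the bracket\<close>

context lie_algebra
begin

lemma br_add_left: "br (u + v) w = br u w + br v w"
  using linear_br_left by (rule Vector_Spaces.linear.axioms(3)[THEN module_hom.add])

lemma br_add_right: "br u (v + w) = br u v + br u w"
  using linear_br_right by (rule Vector_Spaces.linear.axioms(3)[THEN module_hom.add])

lemma br_scale_left: "br (c *s u) w = c *s br u w"
  using linear_br_left by (rule Vector_Spaces.linear.axioms(3)[THEN module_hom.scale])

lemma br_zero_left: "br 0 w = 0"
  using br_scale_left[of 0 0 w] by simp

lemma br_sum_left: "br (sum f A) w = (\<Sum>i\<in>A. br (f i) w)"
  by (induction A rule: infinite_finite_induct) (simp_all add: br_zero_left br_add_left)

lemma br_antisym: "br u v = - br v u"
proof -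
  have "br u v + br v u = br (u + v) (u + v)"
    by (simp add: br_add_left br_add_right br_self[of u] br_self[of v] add.commute)
  then have "br u v + br v u = 0" by (simp add: br_self)
  then show ?thesis by (simp only: eq_neg_iff_add_eq_0)
qed

end

section \<open>Coordinates with respect to the basis\<close>

context lie_algebra_r
begin

text \<open>Giving \<open>x\<close> the index 0 lets \<open>{..2*n}\<close> index the whole basis
  and avoids the unspecified value \<open>e 0\<close>.\<close>

definition b :: "nat \<Rightarrow> 'a" where
  "b k = (if k = 0 then x else e k)"

definition coord :: "nat \<Rightarrow> 'a \<Rightarrow> complex" where
  "coord k v = representation (insert x (e ` {1..2*n})) v (b k)"

lemma image_b: "b ` {..2*n} = insert x (e ` {1..2*n})"
proof -
  have "{..2*n} = insert 0 {1..2*n}" by auto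
  moreover have "b ` {1..2*n} = e ` {1..2*n}" by (intro image_cong) (auto simp: b_def)
  moreover have "b 0 = x" by (simp add: b_def)
  ultimately show ?thesis by (simp del: One_nat_def)
qed

lemma inj_b: "inj_on b {..2*n}"
proof (rule inj_onI)
  fix i j assume "i \<in> {..2*n}" "j \<in> {..2*n}" "b i = b j"
  then show "i = j"
    using basis_distinct(2) inj_onD[OF basis_distinct(1), of i j]
    by (cases "i = 0"; cases "j = 0") (auto simp: b_def)
qed

lemma coord_add: "coord k (u + v) = coord k u + coord k v"
  unfolding coord_def using basis_independent basis_span by (subst representation_add) auto

lemma coord_diff: "coord k (u - v) = coord k u - coord k v"
  unfolding coord_def using basis_independent basis_span by (subst representation_diff) auto

lemma coord_scale: "coord k (c *s u) = c * coord k u"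
  unfolding coord_def using basis_independent basis_span by (subst representation_scale) auto

lemma coord_zero: "coord k 0 = 0"
  by (simp add: coord_def representation_zero)

lemma coord_minus: "coord k (- u) = - coord k u"
  using coord_diff[of k 0 u] by (simp add: coord_zero)

lemma coord_sum: "coord k (sum f A) = (\<Sum>i\<in>A. coord k (f i))"
  by (induction A rule: infinite_finite_induct) (simp_all add: coord_zero coord_add)

lemma coord_b: "k \<le> 2*n \<Longrightarrow> j \<le> 2*n \<Longrightarrow> coord k (b j) = (if k = j then 1 else 0)"
  unfolding coord_def using basis_independent image_b inj_onD[OF inj_b, of k j]
  by (subst representation_basis) auto

lemma coord_e: "k \<le> 2*n \<Longrightarrow> 1 \<le> j \<Longrightarrow> j \<le> 2*n \<Longrightarrow> coord k (e j) = (if k = j then 1 else 0)"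
  using coord_b[of k j] by (simp add: b_def)

lemma coord_x: "k \<le> 2*n \<Longrightarrow> coord k x = (if k = 0 then 1 else 0)"
  using coord_b[of k 0] by (simp add: b_def)

lemma sum_coord: "(\<Sum>k\<le>2*n. coord k v *s b k) = v"
proof -
  have "v = (\<Sum>w\<in>insert x (e ` {1..2*n}). representation (insert x (e ` {1..2*n})) v w *s w)"
    using basis_independent basis_span by (subst sum_representation_eq) auto
  also have "\<dots> = (\<Sum>k\<le>2*n. coord k v *s b k)"
    using inj_b by (simp add: image_b[symmetric] sum.reindex coord_def del: One_nat_def)
  finally show ?thesis ..
qed

lemma coord_eqI: "(\<And>k. k \<le> 2*n \<Longrightarrow> coord k u = coord k v) \<Longrightarrow> u = v"
  using sum_coord[of u] sum_coord[of v] by (metis (mono_tags, lifting) atMost_iff sum.cong)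

lemma coord_sum_e:
  assumes "A \<subseteq> {1..2*n}" "k \<le> 2*n"
  shows "coord k (\<Sum>i\<in>A. a i *s e i) = (if k \<in> A then a k else 0)"
proof -
  have "finite A" using assms(1) finite_subset by blast
  have "coord k (\<Sum>i\<in>A. a i *s e i) = (\<Sum>i\<in>A. if i = k then a i else 0)"
    unfolding coord_sum coord_scale
    using assms by (intro sum.cong refl) (subst coord_e, auto)
  also have "\<dots> = (if k \<in> A then a k else 0)"
    using \<open>finite A\<close> by (simp add: sum.delta)
  finally show ?thesis .
qed

section \<open>Brackets with basis vectors, in coordinates\<close>

lemma coord_br: "coord m (br v w) = (\<Sum>k\<le>2*n. coord k v * coord m (br (b k) w))"
proof -
  have "br v w = (\<Sum>k\<le>2*n. coord k v *s br (b k) w)"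
    by (subst (1) sum_coord[of v, symmetric]) (simp only: br_sum_left br_scale_left)
  then show ?thesis by (simp add: coord_sum coord_scale)
qed

text \<open>Eigenvalue of \<open>b k\<close> under bracketing with \<open>x\<close> on the
  right.\<close>

definition weight :: "nat \<Rightarrow> complex" where
  "weight k = (if k = 0 then 0 else if k = 1 then 1 else if k = 2*n then 2 * of_nat n - 3 + 2 * l
     else of_nat k - 2 + l)"

lemma br_b_x: "k \<le> 2*n \<Longrightarrow> br (b k) x = weight k *s b k"
  using br_e_x[of k] br_e1_x br_e2n_x by (auto simp: b_def weight_def br_self)

lemma coord_br_x:
  assumes "m \<le> 2*n"
  shows "coord m (br v x) = weight m * coord m v"
proof -
  have "coord m (br v x) = (\<Sum>k\<le>2*n. if k = m then coord k v * weight k else 0)"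
    unfolding coord_br[of m v x]
    using assms by (intro sum.cong refl) (auto simp: br_b_x coord_scale coord_b)
  then show ?thesis using assms by (simp add: sum.delta mult.commute)
qed

lemma coord_br_e1:
  assumes "m \<le> 2*n" "n \<ge> 2"
  shows "coord m (br v (e 1)) =
    (if m = 1 then - coord 0 v else if 3 \<le> m \<and> m \<le> 2*n - 1 then coord (m - 1) v else 0)"
proof -
  have *: "br (b k) (e 1) = (if k = 0 then - e 1 else if 2 \<le> k \<and> k \<le> 2*n - 2 then e (k + 1) else 0)"
    if "k \<le> 2*n" for k
  proof -
    consider "k = 0" | "k = 1" | "2 \<le> k \<and> k \<le> 2*n - 2" | "2*n - 2 < k" using that by linarith
    then show ?thesis
    proof cases
      case 4
      have "br (e 1) (e k) = 0" using 4 that assms by (intro br_zero) auto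
      then show ?thesis using 4 that assms br_antisym[of "e k" "e 1"] by (auto simp: b_def)
    qed (use br_antisym[of x "e 1"] br_e1_x br_e1 br_self assms in \<open>auto simp: b_def\<close>)
  qed
  \<comment> \<open>Only \<open>x\<close> and \<open>e (m - 1)\<close> contribute. The range
    condition on \<open>m\<close> also shuts out the truncated \<open>m - 1\<close> at
    \<open>m = 0\<close>.\<close>
  have "coord m (br v (e 1)) = (\<Sum>k\<le>2*n. (if k = 0 then if m = 1 then - coord k v else 0 else 0)
      + (if k = m - 1 then if 3 \<le> m \<and> m \<le> 2*n - 1 then coord k v else 0 else 0))"
    unfolding coord_br[of m v]
  proof (intro sum.cong refl, goal_cases)
    case (1 k)
    then show ?case using assms by (auto simp: * coord_minus coord_e coord_zero split: if_splits simp del: One_nat_def)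
  qed
  also have "\<dots> = (if m = 1 then - coord 0 v else if 3 \<le> m \<and> m \<le> 2*n - 1 then coord (m - 1) v else 0)"
    using assms by (auto simp: sum.distrib sum.delta)
  finally show ?thesis .
qed

text \<open>The sign does not depend on whether \<open>j \<le> n\<close>: exchanging \<open>j\<close> and \<open>2*n + 1 - j\<close> changes both
  the order of the bracket and the parity of the exponent in \<open>br_anti\<close>.\<close>

lemma coord_br_e:
  assumes "m \<le> 2*n" "n \<ge> 2" "2 \<le> j" "j \<le> 2*n - 1"
  shows "coord m (br v (e j)) = (if m = j then - weight j * coord 0 v else 0)
    + (if m = j + 1 \<and> j \<le> 2*n - 2 then - coord 1 v else 0)
    + (if m = 2*n then (-1) ^ (j + 1) * coord (2*n + 1 - j) v else 0)"
proof -
  have bx: "br x (e j) = - weight j *s e j"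
    using br_antisym[of x "e j"] br_b_x[of j] assms by (simp add: b_def)
  have b1: "br (e 1) (e j) = (if j \<le> 2*n - 2 then - e (j + 1) else 0)"
    using br_antisym[of "e 1" "e j"] br_e1[of j] br_zero[of 1 j] assms by auto
  have bk: "br (e k) (e j) = (if k = 2*n + 1 - j then (-1) ^ (j + 1) *s e (2*n) else 0)"
    if "2 \<le> k" "k \<le> 2*n" for k
  proof (cases "k = 2*n + 1 - j")
    case True
    show ?thesis
    proof (cases "j \<le> n")
      case True
      then show ?thesis using \<open>k = _\<close> br_anti[of j] br_antisym[of "e k" "e j"] assms by simp
    next
      case False
      have j: "2*n + 1 - k = j" using True assms by simp
      have "even k = odd j" using True assms by presburger
      then have "(-1 :: complex) ^ k = (-1) ^ (j + 1)" by (simp add: minus_one_power_iff)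
      then show ?thesis using True False br_anti[of k] that assms unfolding j by simp
    qed
  next
    case False
    consider "k < j" | "k = j" | "j < k" by linarith
    then have "br (e k) (e j) = 0"
    proof cases
      case 1
      then show ?thesis using False that assms by (intro br_zero) auto
    next
      case 3
      then have "br (e j) (e k) = 0" using False that assms by (intro br_zero) auto
      then show ?thesis using br_antisym[of "e k" "e j"] by simp
    qed (simp add: br_self)
    then show ?thesis using False by simp
  qed
  have "coord m (br v (e j)) = (\<Sum>k\<le>2*n. (if k = 0 then if m = j then - weight j * coord k v else 0 else 0)
      + (if k = 1 then if m = j + 1 \<and> j \<le> 2*n - 2 then - coord k v else 0 else 0)
      + (if k = 2*n + 1 - j then if m = 2*n then (-1) ^ (j + 1) * coord k v else 0 else 0))"
    unfolding coord_br[of m v]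
  proof (intro sum.cong refl, goal_cases)
    case (1 k)
    consider "k = 0" | "k = 1" | "2 \<le> k" by linarith
    then show ?case
    proof cases
      case 1
      then show ?thesis using assms bx by (auto simp: b_def coord_minus coord_scale coord_e)
    next
      case 2
      then show ?thesis using assms b1 by (auto simp: b_def coord_minus coord_e coord_zero)
    next
      case 3
      then show ?thesis using assms bk[of k] 1 by (auto simp: b_def coord_minus coord_scale coord_e coord_zero)
    qed
  qed
  also have "\<dots> = (if m = j then - weight j * coord 0 v else 0)
    + (if m = j + 1 \<and> j \<le> 2*n - 2 then - coord 1 v else 0)
    + (if m = 2*n then (-1) ^ (j + 1) * coord (2*n + 1 - j) v else 0)"
  proof -
    have "(\<Sum>k\<le>2*n. (if k = 0 then A k else 0) + (if k = 1 then B k else 0)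
        + (if k = 2*n + 1 - j then C k else 0)) = A 0 + B 1 + C (2*n + 1 - j)"
      for A B C :: "nat \<Rightarrow> complex"
      using assms by (auto simp: sum.distrib sum.delta)
    then show ?thesis .
  qed
  finally show ?thesis .
qed

end

section \<open>Coordinate equations for a 1/2-derivation\<close>

locale half_derivation_r = lie_algebra_r +
  fixes \<phi> :: "'a \<Rightarrow> 'a"
  assumes n_ge_3: "n \<ge> 3" and half_derivation: "half_derivation \<phi>"
begin

text \<open>Matrix of \<phi>: column 0 belongs to \<open>x\<close>, and column 1 holds the
  coefficients \<alpha> of the theorem.\<close>

definition f :: "nat \<Rightarrow> nat \<Rightarrow> complex" where
  "f k j = coord k (\<phi> (b j))"

abbreviation \<alpha> :: "nat \<Rightarrow> complex" where "\<alpha> k \<equiv> f k 1"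

text \<open>Simp does not split natural-number subtraction when it decides the index conditions below.\<close>

lemma index_simps [simp]:
  "2 \<le> n" "2 \<le> 2*n - Suc 0" "3 \<le> 2*n - Suc 0" "4 \<le> 2*n - Suc 0" "2 \<le> 2*n - 2" "3 \<le> 2*n - 2"
  "\<not> 2*n \<le> 2*n - Suc 0" "2*n \<noteq> 2*n - Suc 0" "2*n - Suc 0 \<noteq> 2*n" "\<not> 2*n - Suc 0 \<le> 2*n - 2"
  "2*n - Suc 0 \<noteq> 2" "2*n - Suc 0 \<noteq> 3" "Suc (2*n) - (2*n - Suc 0) = 2" "2*n \<noteq> 3"
  "2*n - Suc 0 \<noteq> Suc 0" "Suc 0 \<noteq> 2*n - Suc 0" "2 \<noteq> 2*n - Suc 0" "3 \<noteq> 2*n - Suc 0" "n \<noteq> 0" "n \<noteq> Suc 0"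
  using n_ge_3 by linarith+

lemma coord_\<phi>_e: "1 \<le> j \<Longrightarrow> coord k (\<phi> (e j)) = f k j"
  by (simp add: f_def b_def)

lemma coord_\<phi>_x: "coord k (\<phi> x) = f k 0"
  by (simp add: f_def b_def)

lemma \<phi>_scale: "\<phi> (c *s u) = c *s \<phi> u"
  using half_derivation[unfolded half_derivation_def]
  by (auto intro: module_hom.scale[OF Vector_Spaces.linear.axioms(3)])

lemma \<phi>_zero: "\<phi> 0 = 0"
  using \<phi>_scale[of 0 0] by simp

text \<open>Antisymmetry moves \<phi> into the left slot of both brackets, the slot that the
  coordinate formulas above expand.\<close>

lemma coord_\<phi>_br: "2 * coord k (\<phi> (br u v)) = coord k (br (\<phi> u) v) - coord k (br (\<phi> v) u)"
proof -
  have "\<phi> (br u v) = (1 / 2) *s (br (\<phi> u) v + - br (\<phi> v) u)"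
    using half_derivation[unfolded half_derivation_def] br_antisym[of u "\<phi> v"] by simp
  then show ?thesis by (simp only: coord_add coord_scale coord_minus) simp
qed

text \<open>The pair \<open>(e j, x)\<close>. Outside the rows \<open>j\<close>,
  \<open>j + 1\<close> and \<open>2*n\<close> it forces \<open>f m j = 0\<close> unless
  \<open>weight m = 2 * weight j\<close>.\<close>

lemma eq_e_x:
  assumes "m \<le> 2*n" "2 \<le> j" "j \<le> 2*n - 1"
  shows "2 * (weight j * f m j) = weight m * f m j
    - ((if m = j then - weight j * f 0 0 else 0)
      + (if m = j + 1 \<and> j \<le> 2*n - 2 then - f 1 0 else 0)
      + (if m = 2*n then (-1) ^ (j + 1) * f (2*n + 1 - j) 0 else 0))"
proof -
  have j: "1 \<le> j" "n \<ge> 2" using assms n_ge_3 by auto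
  have br: "br (e j) x = weight j *s e j" using br_b_x[of j] assms by (simp add: b_def)
  show ?thesis
    using coord_\<phi>_br[of m "e j" x]
    unfolding br \<phi>_scale coord_scale coord_br_x[OF assms(1)] coord_br_e[OF assms(1) j(2) assms(2,3)]
      coord_\<phi>_e[OF j(1)] coord_\<phi>_x .
qed

lemma eq_e1_x:
  assumes "m \<le> 2*n"
  shows "2 * f m 1 = weight m * f m 1
    - (if m = 1 then - f 0 0 else if 3 \<le> m \<and> m \<le> 2*n - 1 then f (m - 1) 0 else 0)"
proof -
  have n: "n \<ge> 2" using n_ge_3 by simp
  show ?thesis
    using coord_\<phi>_br[of m "e 1" x]
    unfolding br_e1_x coord_br_x[OF assms(1)] coord_br_e1[OF assms(1) n]
      coord_\<phi>_e[OF order_refl] coord_\<phi>_x .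
qed

lemma f_0_1: "f 0 1 = 0"
  using eq_e1_x[of 0] by (simp add: weight_def)

text \<open>The bracket stays unevaluated: it is \<open>e (j + 1)\<close> for
  \<open>j \<le> 2*n - 2\<close>, which gives the recurrence between columns, and 0 for
  \<open>j = 2*n - 1\<close>, which gives \<open>\<alpha> 2 = 0\<close>.\<close>

lemma coord_\<phi>_br_e_e1:
  assumes "m \<le> 2*n" "2 \<le> j" "j \<le> 2*n - 1"
  shows "2 * coord m (\<phi> (br (e j) (e 1))) =
    (if m = 1 then - f 0 j else if 3 \<le> m \<and> m \<le> 2*n - 1 then f (m - 1) j else 0)
    - ((if m = j then - weight j * f 0 1 else 0)
      + (if m = j + 1 \<and> j \<le> 2*n - 2 then - f 1 1 else 0)
      + (if m = 2*n then (-1) ^ (j + 1) * f (2*n + 1 - j) 1 else 0))"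
proof -
  have j: "1 \<le> j" "n \<ge> 2" using assms n_ge_3 by auto
  show ?thesis
    using coord_\<phi>_br[of m "e j" "e 1"]
    unfolding coord_br_e1[OF assms(1) j(2)] coord_br_e[OF assms(1) j(2) assms(2,3)]
      coord_\<phi>_e[OF j(1)] coord_\<phi>_e[OF order_refl] .
qed

lemma eq_e_e1:
  assumes "m \<le> 2*n" "3 \<le> j" "j \<le> 2*n - 1"
  shows "2 * f m j =
    (if m = 1 then - f 0 (j - 1) else if 3 \<le> m \<and> m \<le> 2*n - 1 then f (m - 1) (j - 1) else 0)
    + (if m = j then \<alpha> 1 else 0)
    + (if m = 2*n then (-1) ^ (j - 1) * \<alpha> (2*n + 2 - j) else 0)"
proof -
  define i where "i = j - 1"
  have i: "i + 1 = j" "2*n + 1 - i = 2*n + 2 - j" "2 \<le> i" "i \<le> 2*n - 2" "i \<le> 2*n - 1"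
    using assms by (auto simp: i_def)
  have "br (e i) (e 1) = e j" using br_e1[of i] i by simp
  then have "2 * f m j = 2 * coord m (\<phi> (br (e i) (e 1)))" using assms by (simp add: coord_\<phi>_e)
  moreover have "(-1 :: complex) ^ j = - ((-1) ^ i)" by (simp add: i(1)[symmetric])
  ultimately show ?thesis
    using coord_\<phi>_br_e_e1[OF assms(1) i(3,5)] i(4)
    unfolding i(1,2) f_0_1 i_def[symmetric] by (auto split: if_splits)
qed

lemma coord_\<phi>_br_e2_e:
  assumes "m \<le> 2*n" "3 \<le> j" "j \<le> 2*n - 1"
  shows "2 * coord m (\<phi> (br (e 2) (e j))) =
    (if m = j then - weight j * f 0 2 else 0)
    + (if m = j + 1 \<and> j \<le> 2*n - 2 then - f 1 2 else 0)
    + (if m = 2*n then (-1) ^ (j + 1) * f (2*n + 1 - j) 2 else 0)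
    - ((if m = 2 then - weight 2 * f 0 j else 0)
      + (if m = 2 + 1 \<and> 2 \<le> 2*n - 2 then - f 1 j else 0)
      + (if m = 2*n then (-1) ^ (2 + 1) * f (2*n + 1 - 2) j else 0))"
proof -
  have j: "1 \<le> j" "n \<ge> 2" "2 \<le> j" "(1::nat) \<le> 2" "(2::nat) \<le> 2" "2 \<le> 2*n - 1" using assms n_ge_3 by auto
  show ?thesis
    using coord_\<phi>_br[of m "e 2" "e j"]
    unfolding coord_br_e[OF assms(1) j(2) j(3) assms(3)] coord_br_e[OF assms(1) j(2) j(5,6)]
      coord_\<phi>_e[OF j(1)] coord_\<phi>_e[OF j(4)] .
qed

lemma eq_e2_e:
  assumes "m \<le> 2*n" "3 \<le> j" "j \<le> 2*n - 2"
  shows "0 = (if m = j then - weight j * f 0 2 else 0)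
    + (if m = j + 1 then - f 1 2 else 0)
    + (if m = 2*n then (-1) ^ (j + 1) * f (2*n + 1 - j) 2 else 0)
    - ((if m = 2 then - weight 2 * f 0 j else 0)
      + (if m = 3 then - f 1 j else 0)
      + (if m = 2*n then - f (2*n - 1) j else 0))"
proof -
  have "br (e 2) (e j) = 0" using assms by (intro br_zero) auto
  then have 0: "2 * coord m (\<phi> (br (e 2) (e j))) = 0" by (simp add: \<phi>_zero coord_zero)
  have j: "(m = j + 1 \<and> j \<le> 2*n - 2) = (m = j + 1)" "(m = 2 + 1 \<and> 2 \<le> 2*n - 2) = (m = 3)"
    "(-1 :: complex) ^ (2 + 1) = -1" "2*n + 1 - 2 = 2*n - 1" "j \<le> 2*n - 1"
    using assms by auto
  show ?thesis using coord_\<phi>_br_e2_e[OF assms(1,2) j(5)] unfolding 0 j(1-4) by simp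
qed

text \<open>Brackets with \<open>e 1\<close> do not reach \<open>e (2*n)\<close>; its column comes
  from \<open>[e 2, e (2*n - 1)] = e (2*n)\<close>.\<close>

lemma eq_e2_e2n:
  assumes "m \<le> 2*n"
  shows "2 * f m (2*n) = (if m = 2*n - 1 then - weight (2*n - 1) * f 0 2 else 0)
    + (if m = 2*n then f 2 2 + f (2*n - 1) (2*n - 1) else 0)
    + (if m = 2 then weight 2 * f 0 (2*n - 1) else 0)
    + (if m = 3 then f 1 (2*n - 1) else 0)"
proof -
  have "br (e 2) (e (2*n - 1)) = e (2*n)" using br_anti[of 2] n_ge_3 by simp
  then show ?thesis using coord_\<phi>_br_e2_e[of m "2*n - 1"] assms n_ge_3
    by (auto simp: coord_\<phi>_e)
qed

section \<open>The columns of the vectors \<open>e j\<close>\<close>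

text \<open>The pair \<open>(e 2, x)\<close> gives nothing at \<open>l = 0\<close>. The pairs
  \<open>(e 2, e 1)\<close> and \<open>(e 2, e 3)\<close> together give
  \<open>(3/2 + l) * f 0 2 = 0\<close>, which settles that case.\<close>

lemma f_0_2: "f 0 2 = 0"
proof -
  have "l * f 0 2 = 0" using eq_e_x[of 0 2] n_ge_3 by (simp add: weight_def)
  moreover have "2 * f 1 3 = - f 0 2"
    using eq_e_e1[of 1 3] n_ge_3 by simp
  moreover have "(- 1 - l) * f 0 2 + f 1 3 = 0"
    using eq_e2_e[of 3 3] n_ge_3 by (simp add: weight_def)
  ultimately show ?thesis by algebra
qed

text \<open>Brackets have no component along \<open>x\<close>, so row 0 vanishes in every column
  whose basis vector is a bracket. Only \<open>e 2\<close> at \<open>l = 0\<close> is not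
  one.\<close>

lemma f_0:
  assumes "1 \<le> j" "j \<le> 2*n"
  shows "f 0 j = 0"
proof -
  consider "j = 1" | "j = 2" | "3 \<le> j" "j \<le> 2*n - 1" | "j = 2*n" using assms by linarith
  then show ?thesis
  proof cases
    case 3
    then show ?thesis using eq_e_e1[of 0 j] by auto
  next
    case 4
    then show ?thesis using eq_e2_e2n[of 0] n_ge_3 by auto
  qed (use f_0_1 f_0_2 in auto)
qed

text \<open>Column 2 is read off from the \<open>e 4\<close> coordinate of
  \<open>[e 2, e 3] = 0\<close>, where \<open>n \<ge> 3\<close> keeps 4 apart from
  \<open>2*n\<close>. Columns 3 to \<open>2*n - 1\<close> reduce to row 0.\<close>

lemma f_1:
  assumes "2 \<le> j" "j \<le> 2*n"
  shows "f 1 j = 0"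
proof -
  consider "j = 2" | "3 \<le> j" "j \<le> 2*n - 1" | "j = 2*n" using assms by linarith
  then show ?thesis
  proof cases
    case 1
    then show ?thesis using eq_e2_e[of 4 3] n_ge_3 by auto
  next
    case 2
    then show ?thesis using eq_e_e1[of 1 j] f_0[of "j - 1"] f_0_1 n_ge_3 by auto
  next
    case 3
    then show ?thesis using eq_e2_e2n[of 1] n_ge_3 by auto
  qed
qed

lemma f_2n:
  assumes "3 \<le> j" "j \<le> 2*n - 1"
  shows "f (2*n) j = (-1) ^ (j - 1) / 2 * \<alpha> (2*n + 2 - j)"
proof -
  have "2 * f (2*n) j = (-1) ^ (j - 1) * \<alpha> (2*n + 2 - j)"
    using eq_e_e1[of "2*n" j] assms n_ge_3 by auto
  then show ?thesis by (simp add: field_simps)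
qed

text \<open>Moving along a diagonal halves the entry; on the main diagonal the entry is averaged
  with \<open>\<alpha> 1\<close>. Row 2 starts afresh, because no bracket with \<open>e 1\<close>
  produces \<open>e 2\<close>.\<close>

lemma f_step:
  assumes "2 \<le> k" "k \<le> 2*n - 1" "3 \<le> j" "j \<le> 2*n - 1"
  shows "2 * f k j = (if k = 2 then 0 else f (k - 1) (j - 1)) + (if k = j then \<alpha> 1 else 0)"
  using eq_e_e1[of k j] f_0_1 assms by auto

text \<open>For \<open>k \<ge> 3\<close> the path stays strictly below the main diagonal, so
  \<open>\<alpha> 1\<close> never enters the recurrence.\<close>

lemma f_shift:
  assumes "j + k \<le> 2*n - 1" "3 \<le> k"
  shows "2 ^ j * f (k + j) (j + 2) = f k 2"
  using assms
proof (induction j)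
  case (Suc j)
  have "2 ^ Suc j * f (k + Suc j) (Suc j + 2) = 2 ^ j * (2 * f (k + Suc j) (Suc j + 2))" by simp
  also have "2 * f (k + Suc j) (Suc j + 2) = f (k + j) (j + 2)"
    using f_step[of "k + Suc j" "Suc j + 2"] Suc.prems by simp
  also have "2 ^ j * f (k + j) (j + 2) = f k 2" using Suc by simp
  finally show ?case .
qed (simp add: numeral_2_eq_2)

text \<open>Both \<open>f k 2\<close> and its shifted copy in row \<open>2*n - 1\<close> occur in
  the \<open>e (2*n)\<close> coordinate of one vanishing bracket. At \<open>k = 2*n - 1\<close> the
  resulting factor would be \<open>1 - 1\<close>, which is why that entry survives as a
  parameter.\<close>

lemma f_k_2:
  assumes "3 \<le> k" "k \<le> 2*n - 2"
  shows "f k 2 = 0"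
proof -
  \<comment> \<open>The number of steps that take row \<open>k\<close> to row
    \<open>2*n - 1\<close>, whose basis vector pairs with \<open>e 2\<close>.\<close>
  define j where "j = 2*n - 1 - k"
  have j: "j + k = 2*n - 1" "1 \<le> j" using assms by (auto simp: j_def)
  have 1: "(-1) ^ (j + 3) * f k 2 + f (2*n - 1) (j + 2) = 0"
  proof -
    have c: "2*n \<noteq> j + 2 + 1" "2*n \<noteq> j + 2" "2*n \<noteq> 2" "3 \<le> j + 2" "j + 2 \<le> 2*n - 2"
        "2*n + 1 - (j + 2) = k" "j + 2 + 1 = j + 3"
      using j assms by linarith+
    then show ?thesis using eq_e2_e[of "2*n" "j + 2"] by (simp add: power_add)
  qed
  have 2: "2 ^ j * f (2*n - 1) (j + 2) = f k 2"
    using f_shift[of j k] j assms by (simp add: add.commute)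
  have "(1 + 2 ^ j * (-1) ^ (j + 3)) * f k 2 = 2 ^ j * ((-1) ^ (j + 3) * f k 2 + f (2*n - 1) (j + 2))"
    unfolding distrib_left 2 by (simp add: distrib_right)
  also have "\<dots> = 0" unfolding 1 by simp
  finally have *: "(1 + 2 ^ j * (-1) ^ (j + 3)) * f k 2 = 0" .
  \<comment> \<open>The summands 1 and \<open>2 ^ j\<close> up to sign have different absolute
    values, so they cannot cancel.\<close>
  have "norm (2 ^ j * (-1) ^ (j + 3) :: complex) \<noteq> norm (-1 :: complex)"
  proof -
    have "1 < (2 :: real) ^ j" using j by (intro one_less_power) auto
    then show ?thesis by (simp add: norm_mult norm_power del: one_less_power)
  qed
  then have "2 ^ j * (-1) ^ (j + 3) \<noteq> (-1 :: complex)" by metis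
  then have "1 + 2 ^ j * (-1) ^ (j + 3) \<noteq> (0 :: complex)"
    by (simp only: add_eq_0_iff not_False_eq_True)
  with * show ?thesis by simp
qed

text \<open>Weights \<open>l\<close> and \<open>1 + l\<close> cannot both vanish.\<close>

lemma f_2_2: "f 2 2 = f 0 0"
proof -
  have "l * (f 2 2 - f 0 0) = 0"
    using eq_e_x[of 2 2] n_ge_3 by (simp add: weight_def algebra_simps)
  moreover have "(1 + l) * (f 3 3 - f 0 0) = 0"
    using eq_e_x[of 3 3] n_ge_3 by (simp add: weight_def algebra_simps)
  moreover have "f 1 1 = f 0 0" using eq_e1_x[of 1] n_ge_3 by (simp add: weight_def)
  moreover have "2 * f 3 3 = f 2 2 + f 1 1" using f_step[of 3 3] n_ge_3 by simp
  ultimately show ?thesis by algebra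
qed

lemma \<alpha>_1: "\<alpha> 1 = f 0 0"
  using eq_e1_x[of 1] n_ge_3 by (simp add: weight_def)

text \<open>The excluded entry \<open>f (2*n - 1) 2\<close> never propagates: column 3 draws on row
  \<open>k - 1\<close>, which is at most \<open>2*n - 2\<close>.\<close>

lemma f_middle:
  assumes "2 \<le> k" "k \<le> 2*n - 1" "2 \<le> j" "j \<le> 2*n - 1" "j = 2 \<Longrightarrow> k \<le> 2*n - 2"
  shows "f k j = (if k = j then \<alpha> 1 else 0)"
  using assms(3,1,2,4,5)
proof (induction j arbitrary: k rule: dec_induct)
  case base
  then show ?case using f_k_2[of k] f_2_2 \<alpha>_1 by (cases "k = 2") auto
next
  case (step j)
  then have "2 * f k (Suc j) = (if k = 2 then 0 else f (k - 1) j) + (if k = Suc j then \<alpha> 1 else 0)"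
    using f_step[of k "Suc j"] by simp
  moreover have "f (k - 1) j = (if k = Suc j then \<alpha> 1 else 0)" if "k \<noteq> 2"
    using step.IH[of "k - 1"] step.prems step.hyps that by (auto simp del: One_nat_def)
  ultimately show ?case using step.hyps by (auto simp del: One_nat_def split: if_splits)
qed

lemma f_col_2n:
  assumes "k \<le> 2*n"
  shows "f k (2*n) = (if k = 2*n then \<alpha> 1 else 0)"
proof -
  have "f 0 2 = 0" "f 0 (2*n - 1) = 0" "f 1 (2*n - 1) = 0"
    using f_0 f_1 n_ge_3 by auto
  then have "2 * f k (2*n) = (if k = 2*n then f 2 2 + f (2*n - 1) (2*n - 1) else 0)"
    using eq_e2_e2n[OF assms] by (auto simp del: One_nat_def)
  moreover have "f 2 2 = \<alpha> 1" "f (2*n - 1) (2*n - 1) = \<alpha> 1"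
    using f_middle n_ge_3 by auto
  ultimately show ?thesis by (auto simp del: One_nat_def)
qed

text \<open>Since \<open>e 2\<close> pairs with \<open>e (2*n - 1)\<close>, the
  \<open>e (2*n)\<close> coordinate of the identity for \<open>[e (2*n - 1), e 1] = 0\<close>
  isolates \<open>\<alpha> 2\<close>.\<close>

lemma \<alpha>_2: "\<alpha> 2 = 0"
proof -
  have "br (e (2*n - 1)) (e 1) = 0"
    using br_zero[of 1 "2*n - 1"] br_antisym[of "e (2*n - 1)" "e 1"] n_ge_3 by simp
  then have "coord (2*n) (\<phi> (br (e (2*n - 1)) (e 1))) = 0" by (simp add: \<phi>_zero coord_zero)
  then show ?thesis using coord_\<phi>_br_e_e1[of "2*n" "2*n - 1"] n_ge_3 by auto
qed

section \<open>The image of \<open>x\<close> and the constraints\<close>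

lemma f_1_x: "f 1 0 = 0"
  using eq_e_x[of 3 2] f_k_2[of 3] n_ge_3 by simp

text \<open>The partner \<open>e j\<close> of \<open>e i\<close>, with
  \<open>i + j = 2*n + 1\<close>, brings \<open>f i 0\<close> into the \<open>e (2*n)\<close>
  coordinate of the pair \<open>(e j, x)\<close>. There \<open>l\<close> cancels:
  \<open>2 * weight j - weight (2*n)\<close> is \<open>2*n + 1 - 2*i\<close>.\<close>

lemma f_x:
  assumes "2 \<le> i" "i \<le> 2*n - 2"
  shows "f i 0 = (2 * of_nat i - 2 * of_nat n - 1) / 2 * \<alpha> (i + 1)"
proof -
  define j where "j = 2*n + 1 - i"
  have j: "3 \<le> j" "j \<le> 2*n - 1" "2*n + 1 - j = i" "2*n + 2 - j = i + 1" using assms by (auto simp: j_def)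
  have jc: "of_nat j = 2 * of_nat n + 1 - (of_nat i :: complex)"
    using assms by (simp add: j_def of_nat_diff)
  define s where "s = (-1 :: complex) ^ (j + 1)"
  have s: "s * s = 1" by (simp add: s_def power_add[symmetric])
  have "(-1 :: complex) ^ (j - 1) = s" using j(1) by (cases j) (auto simp: s_def)
  then have F: "2 * f (2*n) j = s * \<alpha> (i + 1)" unfolding f_2n[OF j(1,2)] j(4) by simp
  have "2 * (weight j * f (2*n) j) = weight (2*n) * f (2*n) j - s * f i 0"
    using eq_e_x[of "2*n" j] j unfolding s_def by auto
  moreover have "weight j = 2 * of_nat n - 1 - of_nat i + l" "weight (2*n) = 2 * of_nat n - 3 + 2 * l"
    using j assms by (auto simp: weight_def jc)
  ultimately have "2 * f i 0 = (2 * of_nat i - 2 * of_nat n - 1) * \<alpha> (i + 1)"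
    using F s by algebra
  then show ?thesis by (simp add: mult.commute)
qed

text \<open>The same comparison for the pair \<open>(e 2, x)\<close>, except that the
  \<open>e (2*n)\<close> entry of column 2 is a free parameter.\<close>

lemma f_x_2n_minus_1: "f (2*n - 1) 0 = (3 - 2 * of_nat n) * f (2*n) 2"
proof -
  have "2 * (weight 2 * f (2*n) 2) = weight (2*n) * f (2*n) 2 + f (2*n - 1) 0"
    using eq_e_x[of "2*n" 2] by simp
  moreover have "weight 2 = l" "weight (2*n) = 2 * of_nat n - 3 + 2 * l" by (simp_all add: weight_def)
  ultimately show ?thesis by algebra
qed

text \<open>The factor is \<open>weight (2*n - 1) - 2 * weight 2\<close>.\<close>

lemma \<beta>_constraint: "(2 * of_nat n - 3 - l) * f (2*n - 1) 2 = 0"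
proof -
  have "weight (2*n - 1) = 2 * of_nat n - 3 + l" using n_ge_3 by (simp add: weight_def of_nat_diff)
  moreover have "2 * (weight 2 * f (2*n - 1) 2) = weight (2*n - 1) * f (2*n - 1) 2"
    using eq_e_x[of "2*n - 1" 2] f_1_x by simp
  moreover have "weight 2 = l" by (simp add: weight_def)
  ultimately show ?thesis by algebra
qed

text \<open>For \<open>i < 2*n\<close> the pair \<open>(e 1, x)\<close> gives
  \<open>f (i - 1) 0 = (i - 4 + l) * \<alpha> i\<close>. Comparison with \<open>f_x\<close> cancels
  \<open>i\<close> and leaves the same factor as \<open>weight (2*n) - 2\<close> for
  \<open>i = 2*n\<close>.\<close>

lemma \<alpha>_constraint:
  assumes "3 \<le> i" "i \<le> 2*n"
  shows "(2 * of_nat n - 5 + 2 * l) * \<alpha> i = 0"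
proof (cases "i = 2*n")
  case True
  have "2 * \<alpha> (2*n) = weight (2*n) * \<alpha> (2*n)" using eq_e1_x[of "2*n"] by simp
  moreover have "weight (2*n) = 2 * of_nat n - 3 + 2 * l" by (simp add: weight_def)
  ultimately show ?thesis unfolding True by algebra
next
  case False
  have "2 * \<alpha> i = weight i * \<alpha> i - f (i - 1) 0" using eq_e1_x[of i] assms False by auto
  moreover have "weight i = of_nat i - 2 + l" using assms False by (simp add: weight_def)
  moreover have "2 * f (i - 1) 0 = (2 * of_nat i - 2 * of_nat n - 3) * \<alpha> i"
    using f_x[of "i - 1"] assms False by (auto simp: of_nat_diff algebra_simps)
  ultimately show ?thesis by algebra
qed

section \<open>Assembling the images of the basis vectors\<close>

lemma \<phi>_e1: "\<phi> (e 1) = \<alpha> 1 *s e 1 + (\<Sum>i=3..2*n. \<alpha> i *s e i)"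
proof (rule coord_eqI)
  fix k assume k: "k \<le> 2*n"
  consider "k = 0" | "k = 1" | "k = 2" | "3 \<le> k" by linarith
  then show "coord k (\<phi> (e 1)) = coord k (\<alpha> 1 *s e 1 + (\<Sum>i=3..2*n. \<alpha> i *s e i))"
    using k n_ge_3 f_0_1 \<alpha>_2
    by cases (simp_all add: coord_add coord_scale coord_e coord_sum_e coord_\<phi>_e)
qed

lemma \<phi>_e2: "\<phi> (e 2) = \<alpha> 1 *s e 2 + f (2*n - 1) 2 *s e (2*n - 1) + f (2*n) 2 *s e (2*n)"
proof (rule coord_eqI)
  fix k assume k: "k \<le> 2*n"
  consider "k = 0" | "k = 1" | "2 \<le> k" "k \<le> 2*n - 2" | "k = 2*n - 1" | "k = 2*n" using k by linarith
  then show "coord k (\<phi> (e 2)) =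
      coord k (\<alpha> 1 *s e 2 + f (2*n - 1) 2 *s e (2*n - 1) + f (2*n) 2 *s e (2*n))"
    using k n_ge_3 f_0_2 f_1[of 2] f_middle[of k 2]
    by cases (auto simp: coord_add coord_scale coord_e coord_\<phi>_e)
qed

lemma \<phi>_e:
  assumes "3 \<le> i" "i \<le> 2*n - 1"
  shows "\<phi> (e i) = \<alpha> 1 *s e i + ((-1) ^ (i - 1) / 2 * \<alpha> (2*n + 2 - i)) *s e (2*n)"
proof (rule coord_eqI)
  fix k assume k: "k \<le> 2*n"
  consider "k = 0" | "k = 1" | "2 \<le> k" "k \<le> 2*n - 1" | "k = 2*n" using k by linarith
  then show "coord k (\<phi> (e i)) =
      coord k (\<alpha> 1 *s e i + ((-1) ^ (i - 1) / 2 * \<alpha> (2*n + 2 - i)) *s e (2*n))"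
    using k assms n_ge_3 f_0[of i] f_1[of i] f_middle[of k i] f_2n[OF assms]
    by cases (auto simp: coord_add coord_scale coord_e coord_\<phi>_e)
qed

lemma \<phi>_e2n: "\<phi> (e (2*n)) = \<alpha> 1 *s e (2*n)"
  by (rule coord_eqI) (use n_ge_3 in \<open>simp add: coord_scale coord_e coord_\<phi>_e f_col_2n\<close>)

lemma \<phi>_x: "\<phi> x = (\<Sum>i=2..2*n - 2. ((2 * of_nat i - 2 * of_nat n - 1) / 2 * \<alpha> (i + 1)) *s e i)
    + ((3 - 2 * of_nat n) * f (2*n) 2) *s e (2*n - 1) + f (2*n) 0 *s e (2*n) + \<alpha> 1 *s x"
  (is "_ = ?v")
proof (rule coord_eqI)
  fix k assume k: "k \<le> 2*n"
  have "coord k (\<Sum>i=2..2*n - 2. ((2 * of_nat i - 2 * of_nat n - 1) / 2 * \<alpha> (i + 1)) *s e i)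
      = (if k \<in> {2..2*n - 2} then (2 * of_nat k - 2 * of_nat n - 1) / 2 * \<alpha> (k + 1) else 0)"
    using k by (intro coord_sum_e) auto
  \<comment> \<open>Rewritten in matrix entries, the right-hand side is column 0 without row 1, and
    \<open>f_1_x\<close> says that this row is zero.\<close>
  then have v: "coord k ?v = (if k \<in> {2..2*n - 2} then f k 0 else 0)
      + (if k = 2*n - 1 then f (2*n - 1) 0 else 0) + (if k = 2*n then f (2*n) 0 else 0)
      + (if k = 0 then f 0 0 else 0)"
    using k n_ge_3 f_x[of k] f_x_2n_minus_1 \<alpha>_1
    by (auto simp: coord_add coord_scale coord_e coord_x)
  consider "k = 0" | "k = 1" | "2 \<le> k" "k \<le> 2*n - 2" | "k = 2*n - 1" | "k = 2*n" using k by linarith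
  then show "coord k (\<phi> x) = coord k ?v"
    unfolding v using n_ge_3 f_1_x by cases (auto simp: coord_\<phi>_x)
qed

end

theorem theorem2p5:
  fixes scale :: "complex \<Rightarrow> 'a::ab_group_add \<Rightarrow> 'a" (infixr "*s" 75)
    and br :: "'a \<Rightarrow> 'a \<Rightarrow> 'a"
    and n :: nat and l :: complex
    and e :: "nat \<Rightarrow> 'a" and x :: 'a
    and \<phi> :: "'a \<Rightarrow> 'a"
  assumes "n \<ge> 3"
    and "lie_algebra_r scale br n l e x"
    and "lie_algebra.half_derivation scale br \<phi>"
  shows "\<exists>(\<alpha> :: nat \<Rightarrow> complex) (\<beta> :: nat \<Rightarrow> complex) (\<delta> :: complex).
      (2 * of_nat n - 3 - l) * \<beta> (2*n - 1) = 0
    \<and> (\<forall>i\<in>{3..2*n}. (2 * of_nat n - 5 + 2 * l) * \<alpha> i = 0)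
    \<and> \<phi> (e 1) = \<alpha> 1 *s e 1 + (\<Sum>i=3..2*n. \<alpha> i *s e i)
    \<and> \<phi> (e 2) = \<alpha> 1 *s e 2 + \<beta> (2*n - 1) *s e (2*n - 1) + \<beta> (2*n) *s e (2*n)
    \<and> (\<forall>i\<in>{3..2*n - 1}.
          \<phi> (e i) = \<alpha> 1 *s e i + ((-1) ^ (i - 1) / 2 * \<alpha> (2*n + 2 - i)) *s e (2*n))
    \<and> \<phi> (e (2*n)) = \<alpha> 1 *s e (2*n)
    \<and> \<phi> x = (\<Sum>i=2..2*n - 2. ((2 * of_nat i - 2 * of_nat n - 1) / 2 * \<alpha> (i + 1)) *s e i)
          + ((3 - 2 * of_nat n) * \<beta> (2*n)) *s e (2*n - 1) + \<delta> *s e (2*n) + \<alpha> 1 *s x"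
proof -
  interpret half_derivation_r scale br n l e x \<phi>
    using assms by (simp add: half_derivation_r_def half_derivation_r_axioms_def lie_algebra_r_def)
  show ?thesis
    \<comment> \<open>The witnesses are column 1, column 2 and the \<open>e (2*n)\<close> entry of
      column 0.\<close>
    by (rule exI[of _ \<alpha>], rule exI[of _ "\<lambda>k. f k 2"], rule exI[of _ "f (2*n) 0"])
      (intro conjI ballI; (rule \<beta>_constraint \<phi>_e1 \<phi>_e2 \<phi>_e2n \<phi>_x \<alpha>_constraint \<phi>_e; simp)?)
qed

end
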